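(* Let $\mathcal G=(\mathcal V,\mathcal E)$ be a finite undirected graph with a fixed vertex ordering $v_1<v_2<\cdots<v_n$ of $\mathcal V$, let $\mathscr S$ be the family of all its maximal stable sets, and let $\tau\in\mathbb Z_{\ge 0}$ be a target value. Let $\bm\Pi=\bm\Pi_F\cup\bm\Pi_I=\{\boldsymbol\pi_1,\ldots,\boldsymbol\pi_q\}\subseteq\mathbb R^{|\mathcal V|}_{\ge 0}$ be a finite set of vectors, where every vector in $\bm\Pi_F$ is dual feasible and every vector $\boldsymbol\pi\in\bm\Pi_I$ satisfies $rc^*(\boldsymbol\pi)<0$, and let $\boldsymbol\delta=(\delta_1,\ldots,\delta_q)$ with $$\delta_h:=\begin{cases}\tau-\sum_{v\in\mathcal V}\pi_{h,v}, & \boldsymbol\pi_h\in\bm\Pi_F,\\ \tau-\sum_{v\in\mathcal V}\pi_{h,v}-(\tau-1)\,rc^*(\boldsymbol\pi_h), & \boldsymbol\pi_h\in\bm\Pi_I.\end{cases}$$ Run the recursive procedure MakeReducedIndSetZDD (defined in the context), which updates $RC[h]$ according to the vertices selected on high branches and applies the pruning test PruneByProp, starting from the root call with $U=\mathcal V$, $i=1$, and $RC[h]=rc(\emptyset,\boldsymbol\pi_h)=1$ for every $h\in\{1,2,\ldots,q\}$. Then the returned ZDD encodes exactly the family $$\mathscr S_{\rm red}:=\{\mathcal S\in\mathscr S:\ rc(\mathcal S,\boldsymbol\pi_h)\le\delta_h\ \text{ for every } h\in\{1,2,\ldots,q\}\}.$$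
   Context: A stable set is a set of pairwise nonadjacent vertices; a maximal stable set is an inclusion-wise maximal one. $N[u]$ denotes the closed neighborhood of $u$ ($u$ together with its neighbors). A vector $\boldsymbol\pi\in\mathbb R^{|\mathcal V|}_{\ge 0}$ is dual feasible if $\sum_{v\in\mathcal S}\pi_v\le 1$ for all $\mathcal S\in\mathscr S$. For $\mathcal S\subseteq\mathcal V$, the reduced cost is $rc(\mathcal S,\boldsymbol\pi):=1-\sum_{v\in\mathcal S}\pi_v$, and $rc^*(\boldsymbol\pi):=\min_{\mathcal S\in\mathscr S}rc(\mathcal S,\boldsymbol\pi)$. $\pi_{h,v}$ is the component of $\boldsymbol\pi_h$ at $v$. ZDD (Zero-Suppressed Binary Decision Diagram): a rooted directed acyclic graph with two terminal nodes $1$ (True) and $0$ (False). Each non-terminal node $a$ is labeled by a vertex of $\mathcal V$ and has a high child $hi(a)$ and a low child $lo(a)$; labels of non-terminal children are strictly larger in the vertex ordering than the label of $a$; and $hi(a)\ne 0$. A root-to-terminal path corresponds to the set of labels of those nodes which the path leaves by the high arc. The ZDD encodes the family of all vertex sets corresponding to root-to-$1$ paths. The root may itself be a terminal: the ZDD $0$ encodes $\emptyset$ and the ZDD $1$ encodes $\{\emptyset\}$. Procedure MakeReducedIndSetZDD$(U,i,RC)$, with input a set $U=\{u_1,\dots,u_m\}\subseteq\mathcal V$ listed in increasing vertex order, an index $i\in\{1,\dots,m+1\}$, and an array $RC\in\mathbb R^q$; it returns a ZDD root node. The nodes created so far are kept in a global table. 1. Let $U_1=\{u_1,\dots,u_{i-1}\}$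 and $U_2=\{u_i,\dots,u_m\}$. If some vertex of $U_1$ has no neighbor in $U_2$, return $0$. 2. If $U=\emptyset$: return $0$ if $RC[h]>\delta_h$ for some $h\in\{1,\dots,q\}$, otherwise return $1$. 3. Let $U_H=U\setminus N[u_i]$, let $RC_H[h]=RC[h]-\pi_{h,u_i}$ for all $h$, and let $l$ be the position within the ordered list $U_H$ of its first vertex that comes after $u_i$ in the vertex ordering ($l=|U_H|+1$ if there is none). 4. If PruneByProp$(RC_H,U_H,l,\bm\Pi,\boldsymbol\delta)$ is true, set $z_h=0$; otherwise set $z_h=$ MakeReducedIndSetZDD$(U_H,l,RC_H)$. 5. If PruneByProp$(RC,U,i+1,\bm\Pi,\boldsymbol\delta)$ is true, set $z_l=0$; otherwise set $z_l=$ MakeReducedIndSetZDD$(U,i+1,RC)$. 6. If $z_h=0$, return $z_l$. 7. If the table already contains a node with label $u_i$, low child $z_l$ and high child $z_h$, return that node; otherwise create such a node, insert it in the table, and return it. The pruning test PruneByProp$(RC,U,i,\bm\Pi,\boldsymbol\delta)$ for $U=\{u_1,\dots,u_m\}$ is true if and only if there exists $h\in\{1,\dots,q\}$ with $RC[h]-\sum_{j\ge i}\pi_{h,u_j}>\delta_h$. (Here $RC[h]$ is the reduced cost, with respect to $\boldsymbol\pi_h$, of the partial stable set selected so far, and $\{u_j\in U:j\ge i\}$ is the candidate set.) *)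

theory Defs
  imports Complex_Main
begin

section \<open>Graphs, stable sets and reduced costs\<close>

definition simple_graph :: "'a set \<Rightarrow> 'a set set \<Rightarrow> bool" where
  "simple_graph V E \<longleftrightarrow> finite V \<and> E \<subseteq> {{u, w} |u w. u \<in> V \<and> w \<in> V \<and> u \<noteq> w}"

definition closed_nbh :: "'a set set \<Rightarrow> 'a \<Rightarrow> 'a set" where
  "closed_nbh E u = insert u {w. {u, w} \<in> E}"

definition stable :: "'a set \<Rightarrow> 'a set set \<Rightarrow> 'a set \<Rightarrow> bool" where
  "stable V E S \<longleftrightarrow> S \<subseteq> V \<and> pairwise (\<lambda>u w. {u, w} \<notin> E) S"

definition maximal_stable_sets :: "'a set \<Rightarrow> 'a set set \<Rightarrow> 'a set set" where
  "maximal_stable_sets V E = {S. stable V E S \<and> (\<forall>S'. stable V E S' \<and> S \<subseteq> S' \<longrightarrow> S' = S)}"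

text \<open>A vector indexed by the vertex set \<open>V\<close> is a function of type \<open>'a \<Rightarrow> real\<close>; only its
  values on \<open>V\<close> are ever used.\<close>

definition dual_feasible :: "'a set \<Rightarrow> 'a set set \<Rightarrow> ('a \<Rightarrow> real) \<Rightarrow> bool" where
  "dual_feasible V E p \<longleftrightarrow>
     (\<forall>v\<in>V. 0 \<le> p v) \<and> (\<forall>S\<in>maximal_stable_sets V E. (\<Sum>v\<in>S. p v) \<le> 1)"

definition rc :: "'a set \<Rightarrow> ('a \<Rightarrow> real) \<Rightarrow> real" where
  "rc S p = 1 - (\<Sum>v\<in>S. p v)"

definition rc_min :: "'a set \<Rightarrow> 'a set set \<Rightarrow> ('a \<Rightarrow> real) \<Rightarrow> real" where
  "rc_min V E p = Min ((\<lambda>S. rc S p) ` maximal_stable_sets V E)"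


section \<open>Zero-suppressed decision diagrams\<close>

text \<open>A node is either one of the two terminals or a reference to an entry of a node table;
  \<open>Ref k\<close> denotes the non-terminal stored at position \<open>k\<close>. Nodes with equal references are
  the same node, so tables describe graphs rather than trees.\<close>

datatype node = Term0 | Term1 | Ref nat

datatype 'a entry = Entry (label: 'a) (lo: node) (hi: node)

type_synonym 'a table = "'a entry list"

definition zdd_arcs :: "'a table \<Rightarrow> (node \<times> node) set" where
  "zdd_arcs T = (\<Union>k<length T. {(Ref k, lo (T ! k)), (Ref k, hi (T ! k))})"

definition zdd_nodes :: "'a table \<Rightarrow> node \<Rightarrow> node set" where
  "zdd_nodes T r = {a. (r, a) \<in> (zdd_arcs T)\<^sup>*}"

text \<open>The part of the table reachable from \<open>r\<close> is a ZDD with root \<open>r\<close>. The bound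
  \<open>k < length T\<close> says that there are no dangling references.\<close>

definition is_zdd :: "('a::linorder) table \<Rightarrow> node \<Rightarrow> bool" where
  "is_zdd T r \<longleftrightarrow>
     acyclic (Restr (zdd_arcs T) (zdd_nodes T r)) \<and>
     (\<forall>k. Ref k \<in> zdd_nodes T r \<longrightarrow>
        k < length T \<and>
        hi (T ! k) \<noteq> Term0 \<and>
        (\<forall>j. Ref j \<in> {lo (T ! k), hi (T ! k)} \<longrightarrow> label (T ! k) < label (T ! j)))"

text \<open>\<open>zdd_path T a b S\<close>: there is a path from \<open>a\<close> to \<open>b\<close> such that \<open>S\<close> is the set of labels of
  the nodes it leaves by the high arc.\<close>

inductive zdd_path :: "'a table \<Rightarrow> node \<Rightarrow> node \<Rightarrow> 'a set \<Rightarrow> bool" for T where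
  empty: "zdd_path T a a {}"
| high: "k < length T \<Longrightarrow> zdd_path T (hi (T ! k)) b S \<Longrightarrow>
           zdd_path T (Ref k) b (insert (label (T ! k)) S)"
| low: "k < length T \<Longrightarrow> zdd_path T (lo (T ! k)) b S \<Longrightarrow> zdd_path T (Ref k) b S"

definition zdd_family :: "'a table \<Rightarrow> node \<Rightarrow> 'a set set" where
  "zdd_family T r = {S. zdd_path T r Term1 S}"

text \<open>Returns the node with the given label, low child and high child, extending the table
  only if it has no such node yet.\<close>

definition get_node :: "'a \<Rightarrow> node \<Rightarrow> node \<Rightarrow> 'a table \<Rightarrow> node \<times> 'a table" where
  "get_node u zl zh T =
     (if Entry u zl zh \<in> set T
      then (Ref (length (takeWhile (\<lambda>e. e \<noteq> Entry u zl zh) T)), T)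
      else (Ref (length T), T @ [Entry u zl zh]))"


section \<open>The procedure\<close>

text \<open>A set \<open>U = {u\<^sub>1, \<dots>, u\<^sub>m}\<close> is passed as the list \<open>us\<close> of its elements in increasing order.
  Indices \<open>i\<close> and \<open>h\<close> count from 1, so \<open>u\<^sub>i\<close> is \<open>us ! (i - 1)\<close>.\<close>

definition prune_by_prop ::
  "nat \<Rightarrow> (nat \<Rightarrow> 'a \<Rightarrow> real) \<Rightarrow> (nat \<Rightarrow> real) \<Rightarrow> (nat \<Rightarrow> real) \<Rightarrow> 'a list \<Rightarrow> nat \<Rightarrow> bool" where
  "prune_by_prop q \<pi> \<delta> RC us i \<longleftrightarrow>
     (\<exists>h\<in>{1..q}. RC h - (\<Sum>j=i..length us. \<pi> h (us ! (j - 1))) > \<delta> h)"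

text \<open>The global node table is threaded through the calls; a call returns the root node
  together with the updated table.\<close>

context
  fixes E :: "('a::linorder) set set"
    and q :: nat
    and \<pi> :: "nat \<Rightarrow> 'a \<Rightarrow> real"
    and \<delta> :: "nat \<Rightarrow> real"
begin

function make_reduced_indset_zdd ::
  "'a list \<Rightarrow> nat \<Rightarrow> (nat \<Rightarrow> real) \<Rightarrow> 'a table \<Rightarrow> node \<times> 'a table" where
  "make_reduced_indset_zdd us i RC T =
     (if \<exists>x\<in>set (take (i - 1) us). \<forall>y\<in>set (drop (i - 1) us). {x, y} \<notin> E then (Term0, T)
      else if us = [] then
        (if \<exists>h\<in>{1..q}. RC h > \<delta> h then (Term0, T) else (Term1, T))
      else
        let u = us ! (i - 1);
            us\<^sub>H = filter (\<lambda>w. w \<notin> closed_nbh E u) us;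
            RC\<^sub>H = (\<lambda>h. RC h - \<pi> h u);
            l = length (takeWhile (\<lambda>w. \<not> u < w) us\<^sub>H) + 1;
            (zh, T\<^sub>1) =
              (if prune_by_prop q \<pi> \<delta> RC\<^sub>H us\<^sub>H l then (Term0, T)
               else make_reduced_indset_zdd us\<^sub>H l RC\<^sub>H T);
            (zl, T\<^sub>2) =
              (if prune_by_prop q \<pi> \<delta> RC us (i + 1) then (Term0, T\<^sub>1)
               else make_reduced_indset_zdd us (i + 1) RC T\<^sub>1)
        in if zh = Term0 then (zl, T\<^sub>2) else get_node u zl zh T\<^sub>2)"
  by pat_completeness auto

termination
proof (relation "measures [\<lambda>(us, i, RC, T). length us, \<lambda>(us, i, RC, T). Suc (length us) - i]",
    goal_cases)
  case 1
  show ?case by simp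
next
  case (2 us i RC T u us\<^sub>H RC\<^sub>H l)
  have "i - 1 < length us"
  proof (rule ccontr)
    assume "\<not> i - 1 < length us"
    with 2(1,2) show False by (cases us) auto
  qed
  then have "length us\<^sub>H < length us"
    unfolding 2(4) by (intro length_filter_less[of u]) (auto simp: 2(3) closed_nbh_def)
  then show ?case by simp
next
  case (3 us i RC T)
  have "i - 1 < length us"
  proof (rule ccontr)
    assume "\<not> i - 1 < length us"
    with 3(1,2) show False by (cases us) auto
  qed
  then show ?case by auto
qed

end

end

theory Submission
  imports Defs
begin

text \<open>After some vertices have been selected, a call works on the set \<open>U\<close> of vertices that are not
  dominated by the selection, of which only those in the final segment \<open>C = {u\<^sub>i, \<dots>, u\<^sub>m}\<close> may still
  be selected. It encodes the maximal stable sets of the subgraph induced by \<open>U\<close> that lie in \<open>C\<close> and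
  meet the reduced cost bounds: those containing \<open>u\<^sub>i\<close> arise from \<open>U - N[u\<^sub>i]\<close> by adding \<open>u\<^sub>i\<close>, the
  others lie in \<open>C - {u\<^sub>i}\<close>. Pruned branches have an empty family because \<open>\<pi> \<ge> 0\<close> makes all of \<open>C\<close>
  the cheapest choice.\<close>

section \<open>Families of maximal stable sets\<close>

text \<open>Domination is required on \<open>U\<close> but selection is allowed only in
  \<open>C\<close>: a vertex skipped earlier may no longer be chosen, yet still needs a neighbor in
  \<open>S\<close>. This two-set form is closed under both branches of the recursion.\<close>

definition completions :: "'a set set \<Rightarrow> 'a set \<Rightarrow> 'a set \<Rightarrow> 'a set set" where
  "completions E U C = {S. S \<subseteq> C \<and> pairwise (\<lambda>x y. {x, y} \<notin> E) S \<and>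
     (\<forall>x\<in>U - S. \<exists>y\<in>S. {x, y} \<in> E)}"

definition bounded_completions :: "'a set set \<Rightarrow> nat \<Rightarrow> (nat \<Rightarrow> 'a \<Rightarrow> real) \<Rightarrow> (nat \<Rightarrow> real) \<Rightarrow>
    (nat \<Rightarrow> real) \<Rightarrow> 'a set \<Rightarrow> 'a set \<Rightarrow> 'a set set" where
  "bounded_completions E q \<pi> \<delta> RC U C =
     {S \<in> completions E U C. \<forall>h\<in>{1..q}. RC h - sum (\<pi> h) S \<le> \<delta> h}"

text \<open>Maximality is a local condition: an outside vertex without a neighbor in
  \<open>S\<close> could be added, and one with such a neighbor conflicts with it in any stable
  superset.\<close>

lemma maximal_stable_sets_eq_completions:
  assumes irrefl: "\<And>x. {x} \<notin> E"
  shows "maximal_stable_sets V E = completions E V V"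
proof (intro equalityI subsetI)
  fix S assume S: "S \<in> maximal_stable_sets V E"
  have st: "stable V E S" and mx: "\<And>S'. stable V E S' \<Longrightarrow> S \<subseteq> S' \<Longrightarrow> S' = S"
    using S by (auto simp: maximal_stable_sets_def)
  have "\<exists>y\<in>S. {x, y} \<in> E" if x: "x \<in> V - S" for x
  proof (rule ccontr)
    assume "\<not> ?thesis"
    then have "stable V E (insert x S)"
      using st x by (auto simp: stable_def pairwise_insert insert_commute)
    with mx[of "insert x S"] x show False by auto
  qed
  with st show "S \<in> completions E V V" by (auto simp: completions_def stable_def)
next
  fix S assume S: "S \<in> completions E V V"
  have "S' = S" if S': "stable V E S'" "S \<subseteq> S'" for S'
  proof (rule ccontr)
    assume "S' \<noteq> S"
    then obtain x where x: "x \<in> S'" "x \<notin> S" using S' by blast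
    then obtain y where "y \<in> S" "{x, y} \<in> E"
      using S S'(1) x unfolding completions_def stable_def by blast
    with x S' irrefl show False
      unfolding stable_def pairwise_def by (metis insert_absorb2 subsetD)
  qed
  then show "S \<in> maximal_stable_sets V E"
    using S by (auto simp: maximal_stable_sets_def completions_def stable_def)
qed

text \<open>Choosing \<open>u\<close> both forbids and dominates its neighbors, so
  \<open>closed_nbh E u\<close> leaves both sets. Not choosing \<open>u\<close> shrinks only the
  candidates: \<open>U\<close>, and with it the demand for domination, stays the same.\<close>

lemma completions_insert:
  "completions E U (insert u C) =
    insert u ` completions E (U - closed_nbh E u) (C - closed_nbh E u) \<union> completions E U C"
proof (intro equalityI subsetI)
  fix S assume S: "S \<in> completions E U (insert u C)"
  show "S \<in> insert u ` completions E (U - closed_nbh E u) (C - closed_nbh E u) \<union> completions E U C"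
  proof (cases "u \<in> S")
    case False
    with S show ?thesis by (auto simp: completions_def)
  next
    case True
    have "S - {u} \<subseteq> C - closed_nbh E u"
      using S True by (auto simp: completions_def closed_nbh_def pairwise_def)
    moreover have "pairwise (\<lambda>x y. {x, y} \<notin> E) (S - {u})"
      using S by (auto simp: completions_def pairwise_def)
    \<comment> \<open>As \<open>x\<close> lies outside \<open>closed_nbh E u\<close>, the vertex of
      \<open>S\<close> that dominates it cannot be \<open>u\<close>.\<close>
    moreover have "\<exists>y\<in>S - {u}. {x, y} \<in> E" if x: "x \<in> U - closed_nbh E u - (S - {u})" for x
    proof -
      have "x \<in> U - S" using x by (auto simp: closed_nbh_def)
      then obtain y where "y \<in> S" "{x, y} \<in> E" using S by (auto simp: completions_def)
      with x show ?thesis by (auto simp: closed_nbh_def insert_commute)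
    qed
    ultimately have "S - {u} \<in> completions E (U - closed_nbh E u) (C - closed_nbh E u)"
      by (simp add: completions_def)
    moreover have "S = insert u (S - {u})" using True by auto
    ultimately show ?thesis by blast
  qed
next
  fix S assume "S \<in> insert u ` completions E (U - closed_nbh E u) (C - closed_nbh E u) \<union>
    completions E U C"
  then consider "S \<in> completions E U C"
    | S' where "S = insert u S'" "S' \<in> completions E (U - closed_nbh E u) (C - closed_nbh E u)"
    by auto
  then show "S \<in> completions E U (insert u C)"
  proof cases
    case 1
    then show ?thesis by (auto simp: completions_def)
  next
    case 2
    have "pairwise (\<lambda>x y. {x, y} \<notin> E) S"
      using 2 by (auto simp: completions_def pairwise_insert closed_nbh_def insert_commute)
    moreover have "\<exists>y\<in>S. {x, y} \<in> E" if "x \<in> U - S" for x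
    proof (cases "x \<in> closed_nbh E u")
      case True
      with that 2(1) show ?thesis by (auto simp: closed_nbh_def insert_commute)
    next
      case False
      with that 2 show ?thesis by (auto simp: completions_def)
    qed
    ultimately show ?thesis using 2 by (auto simp: completions_def)
  qed
qed

lemma bounded_completions_insert:
  assumes fin: "finite C"
  shows "bounded_completions E q \<pi> \<delta> RC U (insert u C) =
    insert u ` bounded_completions E q \<pi> \<delta> (\<lambda>h. RC h - \<pi> h u)
      (U - closed_nbh E u) (C - closed_nbh E u) \<union>
    bounded_completions E q \<pi> \<delta> RC U C"
proof -
  \<comment> \<open>Completions of the high branch are finite and avoid \<open>u\<close>, so the
    term of \<open>u\<close> splits off and can be moved into \<open>RC\<close>.\<close>
  have "sum (\<pi> h) (insert u S) = \<pi> h u + sum (\<pi> h) S"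
    if "S \<in> completions E (U - closed_nbh E u) (C - closed_nbh E u)" for S h
  proof -
    have "finite S" "u \<notin> S"
      using that fin by (auto simp: completions_def closed_nbh_def intro: finite_subset)
    then show ?thesis by simp
  qed
  then show ?thesis
    unfolding bounded_completions_def completions_insert
    by (auto simp: diff_diff_eq)
qed

text \<open>Justifies the first test of the procedure: \<open>x\<close> can no longer be selected,
  and no candidate could dominate it.\<close>

lemma bounded_completions_undominated:
  assumes "x \<in> U" "x \<notin> C" "\<forall>y\<in>C. {x, y} \<notin> E"
  shows "bounded_completions E q \<pi> \<delta> RC U C = {}"
  using assms by (fastforce simp: bounded_completions_def completions_def)

text \<open>The sum is monotone in the set, so an index \<open>h\<close> whose bound fails at
  \<open>C\<close> fails at every subset of \<open>C\<close>.\<close>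

lemma bounded_completions_pruned:
  assumes "finite C" "\<And>h v. h \<in> {1..q} \<Longrightarrow> v \<in> C \<Longrightarrow> 0 \<le> \<pi> h v"
    and "\<exists>h\<in>{1..q}. RC h - sum (\<pi> h) C > \<delta> h"
  shows "bounded_completions E q \<pi> \<delta> RC U C = {}"
proof -
  obtain h where h: "h \<in> {1..q}" "RC h - sum (\<pi> h) C > \<delta> h" using assms by auto
  have "\<not> RC h - sum (\<pi> h) S \<le> \<delta> h" if "S \<subseteq> C" for S
    using sum_mono2[OF assms(1) that, of "\<pi> h"] assms(2)[OF h(1)] h(2) by auto
  with h(1) show ?thesis
    unfolding bounded_completions_def completions_def by blast
qed

section \<open>Well-formed node tables\<close>

text \<open>Children precede their parents in the table, which makes it acyclic.\<close>

definition wf_table :: "'a::linorder table \<Rightarrow> bool" where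
  "wf_table T \<longleftrightarrow> (\<forall>k<length T. hi (T ! k) \<noteq> Term0 \<and>
     (\<forall>j. Ref j \<in> {lo (T ! k), hi (T ! k)} \<longrightarrow> j < k \<and> label (T ! k) < label (T ! j)))"

text \<open>Terminals qualify vacuously. \<open>C = UNIV\<close> says only that a reference is not
  dangling; a smaller \<open>C\<close> supplies the label bounds needed when a parent is placed
  above \<open>a\<close>.\<close>

definition labelled_in :: "'a table \<Rightarrow> 'a set \<Rightarrow> node \<Rightarrow> bool" where
  "labelled_in T C a \<longleftrightarrow> (\<forall>j. a = Ref j \<longrightarrow> j < length T \<and> label (T ! j) \<in> C)"

lemma labelled_in_mono: "labelled_in T C a \<Longrightarrow> C \<subseteq> D \<Longrightarrow> labelled_in T D a"
  by (auto simp: labelled_in_def)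

lemma labelled_in_append: "labelled_in T C a \<Longrightarrow> labelled_in (T @ zs) C a"
  by (auto simp: labelled_in_def nth_append)

lemma labelled_in_terminal [simp]: "labelled_in T C Term0" "labelled_in T C Term1"
  by (auto simp: labelled_in_def)

lemma wf_table_children:
  assumes "wf_table T" "k < length T"
  shows "labelled_in T UNIV (lo (T ! k))" "labelled_in T UNIV (hi (T ! k))"
  using assms by (fastforce simp: wf_table_def labelled_in_def)+

text \<open>Children of old entries are old by \<open>wf_table\<close>, so a path that starts in
  \<open>T\<close> never reaches the appended entries.\<close>

lemma zdd_path_appendD:
  assumes "zdd_path (T @ zs) a b S" "wf_table T" "labelled_in T UNIV a"
  shows "zdd_path T a b S"
  using assms
proof (induction rule: zdd_path.induct)
  case (empty a)
  show ?case by (rule zdd_path.empty)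
next
  case (high k b S)
  then have k: "k < length T" by (simp add: labelled_in_def)
  with high wf_table_children[of T k] zdd_path.high[OF k, of b S] show ?case
    by (simp add: nth_append)
next
  case (low k b S)
  then have k: "k < length T" by (simp add: labelled_in_def)
  with low wf_table_children[of T k] zdd_path.low[OF k, of b S] show ?case
    by (simp add: nth_append)
qed

lemma zdd_path_appendI:
  assumes "zdd_path T a b S"
  shows "zdd_path (T @ zs) a b S"
  using assms
proof (induction rule: zdd_path.induct)
  case (empty a)
  show ?case by (rule zdd_path.empty)
next
  case (high k b S)
  then show ?case using zdd_path.high[of k "T @ zs" b S] by (simp add: nth_append)
next
  case (low k b S)
  then show ?case using zdd_path.low[of k "T @ zs" b S] by (simp add: nth_append)
qed

text \<open>Lets the result of the high call keep its meaning while the low call extends the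
  table.\<close>

lemma zdd_family_append:
  assumes "wf_table T" "labelled_in T UNIV a"
  shows "zdd_family (T @ zs) a = zdd_family T a"
  using assms zdd_path_appendD zdd_path_appendI by (auto simp: zdd_family_def)

lemma zdd_family_Term0 [simp]: "zdd_family T Term0 = {}"
  by (auto simp: zdd_family_def zdd_path.simps[of T Term0])

lemma zdd_family_Term1 [simp]: "zdd_family T Term1 = {{}}"
  by (auto simp: zdd_family_def zdd_path.simps[of T Term1])

text \<open>The diagram counterpart of \<open>completions_insert\<close>.\<close>

lemma zdd_family_Ref:
  assumes "k < length T"
  shows "zdd_family T (Ref k) =
    insert (label (T ! k)) ` zdd_family T (hi (T ! k)) \<union> zdd_family T (lo (T ! k))"
proof -
  have "zdd_path T (Ref k) Term1 S \<longleftrightarrow>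
    (\<exists>S'. S = insert (label (T ! k)) S' \<and> zdd_path T (hi (T ! k)) Term1 S') \<or>
    zdd_path T (lo (T ! k)) Term1 S" for S
    using assms by (subst zdd_path.simps) auto
  then show ?thesis by (auto simp: zdd_family_def)
qed

lemma is_zdd_wf_table:
  assumes wf: "wf_table T" and r: "labelled_in T C r"
  shows "is_zdd T r"
proof -
  \<comment> \<open>Terminals get rank 0 and references start at 1, so every arc, even one from
    \<open>Ref 0\<close> to a terminal, strictly lowers the rank.\<close>
  define rank where "rank a = (case a of Ref k \<Rightarrow> Suc k | _ \<Rightarrow> 0)" for a
  have "zdd_arcs T \<subseteq> (measure rank)\<inverse>"
    using wf by (fastforce simp: zdd_arcs_def rank_def wf_table_def split: node.splits)
  moreover have "acyclic ((measure rank)\<inverse>)"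
    by (simp add: wf_acyclic)
  ultimately have "acyclic (Restr (zdd_arcs T) (zdd_nodes T r))"
    by (meson acyclic_subset inf_le1 order_trans)
  moreover have "labelled_in T UNIV a" if "(r, a) \<in> (zdd_arcs T)\<^sup>*" for a
    using that
  proof (induction rule: rtrancl_induct)
    case base
    show ?case using r by (rule labelled_in_mono) simp
  next
    case (step a b)
    then show ?case using wf_table_children[OF wf] by (auto simp: zdd_arcs_def)
  qed
  then have "k < length T" if "Ref k \<in> zdd_nodes T r" for k
    using that by (auto simp: zdd_nodes_def labelled_in_def)
  ultimately show ?thesis
    using wf by (auto simp: is_zdd_def wf_table_def)
qed

text \<open>The contract of a call started with table \<open>T\<close>. Growth by appending
  preserves earlier results, and the label set \<open>C\<close> lets the caller put a smaller label
  above the returned node.\<close>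

definition encodes :: "'a::linorder table \<Rightarrow> 'a set \<Rightarrow> 'a set set \<Rightarrow> node \<times> 'a table \<Rightarrow> bool" where
  "encodes T C F = (\<lambda>(r, T'). (\<exists>zs. T' = T @ zs) \<and> wf_table T' \<and> labelled_in T' C r \<and>
     zdd_family T' r = F)"

lemma encodes_terminal [simp]:
  "encodes T C F (Term0, T) \<longleftrightarrow> wf_table T \<and> F = {}"
  "encodes T C F (Term1, T) \<longleftrightarrow> wf_table T \<and> F = {{}}"
  by (auto simp: encodes_def)

text \<open>Treats reuse and creation alike: \<open>zs\<close> is empty if an equal entry exists and
  is the new entry otherwise.\<close>

lemma get_node_eq:
  obtains k zs where "get_node u zl zh T = (Ref k, T @ zs)" "k < length (T @ zs)"
    "(T @ zs) ! k = Entry u zl zh" "zs = [] \<or> zs = [Entry u zl zh]"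
proof (cases "Entry u zl zh \<in> set T")
  case True
  define k where "k = length (takeWhile (\<lambda>e. e \<noteq> Entry u zl zh) T)"
  have k: "k < length T"
    using True unfolding k_def
    by (metis (mono_tags, lifting) length_takeWhile_le nat_less_le takeWhile_eq_all_conv
        takeWhile_eq_take take_all_iff order_refl)
  then have "T ! k = Entry u zl zh"
    using nth_length_takeWhile[of "\<lambda>e. e \<noteq> Entry u zl zh" T] by (simp add: k_def)
  with True k that[of k "[]"] show ?thesis by (simp add: get_node_def k_def)
next
  case False
  with that[of "length T" "[Entry u zl zh]"] show ?thesis by (simp add: get_node_def)
qed

text \<open>Joins the two branches. If \<open>zh = Term0\<close>, the high family is empty and the
  node can be suppressed. Otherwise \<open>zh\<close>, computed in \<open>T1\<close>, is transported
  to \<open>T2\<close> before the family of the node is read off.\<close>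

lemma encodes_node:
  assumes H: "encodes T CH FH (zh, T1)" and L: "encodes T1 CL FL (zl, T2)"
    and gt: "\<forall>v\<in>CH \<union> CL. u < v" and sub: "CL \<subseteq> C" "u \<in> C"
  shows "encodes T C (insert u ` FH \<union> FL) (if zh = Term0 then (zl, T2) else get_node u zl zh T2)"
proof -
  obtain ys1 ys2 where T1: "T1 = T @ ys1" and T2: "T2 = T1 @ ys2"
    using H L by (auto simp: encodes_def)
  have wf1: "wf_table T1" and h1: "labelled_in T1 CH zh" and FH: "zdd_family T1 zh = FH"
    using H by (auto simp: encodes_def)
  have wf: "wf_table T2" and l2: "labelled_in T2 CL zl" and FL: "zdd_family T2 zl = FL"
    using L by (auto simp: encodes_def)
  show ?thesis
  proof (cases "zh = Term0")
    case True
    with FH have "FH = {}" by simp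
    with True L T1 T2 labelled_in_mono[OF l2 sub(1)] show ?thesis by (simp add: encodes_def)
  next
    case False
    have h2: "labelled_in T2 CH zh" using h1 T2 by (simp add: labelled_in_append)
    have FH2: "zdd_family T2 zh = FH"
      using zdd_family_append[OF wf1 labelled_in_mono[OF h1]] FH T2 by simp
    obtain k zs where k: "get_node u zl zh T2 = (Ref k, T2 @ zs)" "k < length (T2 @ zs)"
      "(T2 @ zs) ! k = Entry u zl zh" "zs = [] \<or> zs = [Entry u zl zh]"
      by (rule get_node_eq)
    \<comment> \<open>Both children already lie in \<open>T2\<close>, and \<open>gt\<close> puts
      their labels above \<open>u\<close>.\<close>
    have "wf_table (T2 @ [Entry u zl zh])"
      using wf h2 l2 False gt
      by (auto simp: wf_table_def nth_append labelled_in_def less_Suc_eq)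
        (metis order.strict_trans)+
    with k(4) wf have wf': "wf_table (T2 @ zs)" by auto
    have "zdd_family (T2 @ zs) (Ref k) = insert u ` FH \<union> FL"
      using zdd_family_Ref[OF k(2)] k(3) FH2 FL
        zdd_family_append[OF wf labelled_in_mono[OF h2]]
        zdd_family_append[OF wf labelled_in_mono[OF l2]] by simp
    moreover have "labelled_in (T2 @ zs) C (Ref k)"
      using k sub by (simp add: labelled_in_def)
    ultimately show ?thesis
      using False k(1) wf' T1 T2 by (simp add: encodes_def)
  qed
qed

section \<open>Correctness of the procedure\<close>

text \<open>The recursion equation is unconditional, so it makes the simplifier loop.\<close>
declare make_reduced_indset_zdd.simps [simp del]

text \<open>Distinctness turns the indexed sum into a sum over a set. The bound on \<open>i\<close>
  matters because \<open>i - 1\<close> truncates: index 0 would repeat the term of index 1.\<close>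

lemma prune_by_prop_iff:
  assumes "distinct us" "1 \<le> i"
  shows "prune_by_prop q \<pi> \<delta> RC us i \<longleftrightarrow>
    (\<exists>h\<in>{1..q}. RC h - sum (\<pi> h) (set (drop (i - 1) us)) > \<delta> h)"
proof -
  have "(\<Sum>j=i..length us. f (us ! (j - 1))) = sum f (set (drop (i - 1) us))" for f :: "'a \<Rightarrow> real"
  proof -
    have "(\<Sum>j=i..length us. f (us ! (j - 1))) = (\<Sum>j=i-1..<length us. f (us ! j))"
      using assms(2)
      by (intro sum.reindex_bij_witness[of _ Suc "\<lambda>j. j - 1"]) auto
    also have "\<dots> = sum_list (map f (drop (i - 1) us))"
      by (simp add: sum_list_sum_nth sum.shift_bounds_nat_ivl flip: drop_map)
        (rule sum.reindex_bij_witness[of _ "\<lambda>j. j + (i - 1)" "\<lambda>j. j - (i - 1)"]; auto)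
    also have "\<dots> = sum f (set (drop (i - 1) us))"
      using assms(1) by (simp add: sum_list_distinct_conv_sum_set)
    finally show ?thesis .
  qed
  then show ?thesis by (simp add: prune_by_prop_def)
qed

text \<open>In a sorted list the vertices not above \<open>u\<close> form a prefix, so the index
  given to the high call cuts the list exactly after them.\<close>

lemma set_drop_takeWhile_not_less:
  assumes "sorted us"
  shows "set (drop (length (takeWhile (\<lambda>w. \<not> u < w) us)) us) = {w \<in> set us. u < w}"
  using assms by (induction us) (auto dest: order.strict_trans2)

lemma encodes_make_reduced_indset_zdd:
  assumes "sorted us" "distinct us" "1 \<le> i" "wf_table T"
    and "\<And>h v. h \<in> {1..q} \<Longrightarrow> v \<in> set us \<Longrightarrow> 0 \<le> \<pi> h v"
  shows "encodes T (set (drop (i - 1) us))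
    (bounded_completions E q \<pi> \<delta> RC (set us) (set (drop (i - 1) us)))
    (make_reduced_indset_zdd E q \<pi> \<delta> us i RC T)"
  using assms
proof (induction us i RC T rule: make_reduced_indset_zdd.induct[where E = E and q = q and \<pi> = \<pi> and \<delta> = \<delta>])
  case (1 us i RC T)
  note srt = 1(3) and dst = 1(4) and i = 1(5) and wf = 1(6) and nonneg = 1(7)
  let ?C = "set (drop (i - 1) us)"
  consider (undom) "\<exists>x\<in>set (take (i - 1) us). \<forall>y\<in>?C. {x, y} \<notin> E"
    | (empty) "us = []"
    | (step) "\<not> (\<exists>x\<in>set (take (i - 1) us). \<forall>y\<in>?C. {x, y} \<notin> E)" "us \<noteq> []"
    by blast
  then show ?case
  proof cases
    case undom
    then obtain x where x: "x \<in> set (take (i - 1) us)" "\<forall>y\<in>?C. {x, y} \<notin> E" by blast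
    then have "x \<in> set us" "x \<notin> ?C"
      using set_take_disj_set_drop_if_distinct[OF dst, of "i - 1" "i - 1"]
      by (auto dest: in_set_takeD)
    from bounded_completions_undominated[OF this x(2)] undom wf show ?thesis
      by (subst make_reduced_indset_zdd.simps) simp
  next
    case empty
    have "bounded_completions E q \<pi> \<delta> RC {} {} =
        (if \<exists>h\<in>{1..q}. RC h > \<delta> h then {} else {{}})"
      by (force simp: bounded_completions_def completions_def not_less)
    with empty wf show ?thesis
      by (subst make_reduced_indset_zdd.simps) simp
  next
    case step
    \<comment> \<open>If no candidates were left, every vertex of the nonempty \<open>us\<close>
      would lie in the prefix and vacuously lack a neighbor in \<open>?C\<close>, so the first test
      would have succeeded.\<close>
    have len: "i - 1 < length us"
    proof (rule ccontr)
      assume "\<not> i - 1 < length us"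
      with step show False by (cases us) auto
    qed
    define u where "u = us ! (i - 1)"
    define usH where "usH = filter (\<lambda>w. w \<notin> closed_nbh E u) us"
    define RCH where "RCH = (\<lambda>h. RC h - \<pi> h u)"
    define l where "l = length (takeWhile (\<lambda>w. \<not> u < w) usH) + 1"
    \<comment> \<open>\<open>A\<close> and \<open>B\<close> name the two guarded calls;
      \<open>B\<close> starts from the table \<open>T1\<close> that \<open>A\<close> leaves
      behind.\<close>
    define A where "A = (if prune_by_prop q \<pi> \<delta> RCH usH l then (Term0, T)
      else make_reduced_indset_zdd E q \<pi> \<delta> usH l RCH T)"
    obtain zh T1 where zh: "A = (zh, T1)" by fastforce
    define B where "B = (if prune_by_prop q \<pi> \<delta> RC us (i + 1) then (Term0, T1)
      else make_reduced_indset_zdd E q \<pi> \<delta> us (i + 1) RC T1)"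
    obtain zl T2 where zl: "B = (zl, T2)" by fastforce
    let ?D = "set (drop i us)" and ?CH = "set (drop (l - 1) usH)"
    \<comment> \<open>The recursion equation is instantiated at this call, so that rewriting unfolds
      it only once.\<close>
    have result: "make_reduced_indset_zdd E q \<pi> \<delta> us i RC T =
        (if zh = Term0 then (zl, T2) else get_node u zl zh T2)"
      by (simp only: make_reduced_indset_zdd.simps[where us = us and i = i and RC = RC and T = T]
          if_not_P[OF step(1)] if_not_P[OF step(2)] Let_def u_def[symmetric] usH_def[symmetric]
          RCH_def[symmetric] l_def[symmetric] A_def[symmetric] zh prod.case B_def[symmetric] zl)
    have drop: "drop (i - 1) us = u # drop i us"
      using Cons_nth_drop_Suc[OF len] i by (simp add: u_def)
    have "sorted (u # drop i us)" "distinct (u # drop i us)"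
      using sorted_wrt_drop[OF srt, of "i - 1"] distinct_drop[OF dst, of "i - 1"] drop by auto
    then have D: "\<forall>v\<in>?D. u < v" "u \<notin> ?D" by (auto simp: order_less_le)
    have take: "\<forall>v\<in>set (take (i - 1) us). v \<le> u"
    proof -
      have "sorted (take (i - 1) us @ u # drop i us)"
        using srt by (metis append_take_drop_id drop)
      then show ?thesis by (auto simp: sorted_append)
    qed
    have us: "set us = set (take (i - 1) us) \<union> insert u ?D"
      by (metis append_take_drop_id drop list.simps(15) set_append)
    have usH: "set usH = set us - closed_nbh E u" "sorted usH" "distinct usH"
      using srt dst by (auto simp: usH_def sorted_wrt_filter)
    \<comment> \<open>Prefix vertices are at most \<open>u\<close>, so the vertices of
      \<open>usH\<close> above \<open>u\<close> all come from \<open>?D\<close>.\<close>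
    have CH: "?CH = ?D - closed_nbh E u"
      using set_drop_takeWhile_not_less[OF usH(2), of u] us take D usH(1)
      by (auto simp: l_def not_less)
    have nonnegH: "0 \<le> \<pi> h v" if "h \<in> {1..q}" "v \<in> set usH" for h v
      using nonneg that usH(1) by auto
    have H: "encodes T ?CH (bounded_completions E q \<pi> \<delta> RCH (set usH) ?CH) A"
    proof (cases "prune_by_prop q \<pi> \<delta> RCH usH l")
      case True
      then have "bounded_completions E q \<pi> \<delta> RCH (set usH) ?CH = {}"
        using nonnegH by (intro bounded_completions_pruned)
          (auto simp: prune_by_prop_iff[OF usH(3)] l_def dest: in_set_dropD)
      with True wf show ?thesis by (simp add: A_def)
    next
      case False
      have "encodes T ?CH (bounded_completions E q \<pi> \<delta> RCH (set usH) ?CH)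
          (make_reduced_indset_zdd E q \<pi> \<delta> usH l RCH T)"
        by (rule 1(1)[OF step u_def usH_def RCH_def l_def False])
          (use usH wf nonnegH in \<open>auto simp: l_def\<close>)
      with False show ?thesis by (simp add: A_def)
    qed
    then have wf1: "wf_table T1" by (simp add: zh encodes_def)
    have L: "encodes T1 ?D (bounded_completions E q \<pi> \<delta> RC (set us) ?D) B"
    proof (cases "prune_by_prop q \<pi> \<delta> RC us (i + 1)")
      case True
      then have "bounded_completions E q \<pi> \<delta> RC (set us) ?D = {}"
        using nonneg by (intro bounded_completions_pruned)
          (auto simp: prune_by_prop_iff[OF dst] dest: in_set_dropD)
      with True wf1 show ?thesis by (simp add: B_def)
    next
      case False
      have "encodes T1 (set (drop (i + 1 - 1) us))
          (bounded_completions E q \<pi> \<delta> RC (set us) (set (drop (i + 1 - 1) us)))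
          (make_reduced_indset_zdd E q \<pi> \<delta> us (i + 1) RC T1)"
        by (rule 1(2)[OF step u_def usH_def RCH_def l_def zh[unfolded A_def, symmetric] refl False])
          (use srt dst wf1 nonneg in auto)
      with False show ?thesis by (simp add: B_def)
    qed
    \<comment> \<open>By \<open>CH\<close> both label sets lie in \<open>?D\<close>, hence above
      \<open>u\<close>, as \<open>encodes_node\<close> requires.\<close>
    have "encodes T ?C (insert u ` bounded_completions E q \<pi> \<delta> RCH (set usH) ?CH \<union>
        bounded_completions E q \<pi> \<delta> RC (set us) ?D)
        (if zh = Term0 then (zl, T2) else get_node u zl zh T2)"
      unfolding drop
      using H L D CH by (intro encodes_node[of T ?CH _ zh T1 ?D]) (auto simp: zh zl)
    moreover have "bounded_completions E q \<pi> \<delta> RC (set us) ?C =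
        insert u ` bounded_completions E q \<pi> \<delta> RCH (set usH) ?CH \<union>
        bounded_completions E q \<pi> \<delta> RC (set us) ?D"
      unfolding drop CH usH(1) RCH_def list.set(2)
      by (rule bounded_completions_insert) simp
    ultimately show ?thesis by (simp only: result)
  qed
qed

text \<open>The root call is the case \<open>U = C = V\<close> with an empty table. Subtracting
  \<open>sum (\<pi> h) S\<close> from the initial value \<open>rc {} (\<pi> h)\<close> gives
  \<open>rc S (\<pi> h)\<close>, so the bounds become those of the reduced family.\<close>

theorem corollary1:
  fixes V :: "('a::linorder) set"
    and E :: "'a set set"
    and \<tau> q :: nat
    and \<pi> :: "nat \<Rightarrow> 'a \<Rightarrow> real"
    and PiF PiI :: "('a \<Rightarrow> real) set"
    and \<delta> :: "nat \<Rightarrow> real"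
    and r :: node
    and T :: "'a table"
  assumes "simple_graph V E"
    and "PiF \<union> PiI = \<pi> ` {1..q}"
    and "\<forall>p\<in>PiF \<union> PiI. \<forall>v\<in>V. 0 \<le> p v"
    and "\<forall>p\<in>PiF. dual_feasible V E p"
    and "\<forall>p\<in>PiI. rc_min V E p < 0"
    and "\<forall>h\<in>{1..q}. \<pi> h \<in> PiF \<longrightarrow> \<delta> h = real \<tau> - (\<Sum>v\<in>V. \<pi> h v)"
    and "\<forall>h\<in>{1..q}. \<pi> h \<in> PiI \<longrightarrow>
           \<delta> h = real \<tau> - (\<Sum>v\<in>V. \<pi> h v) - (real \<tau> - 1) * rc_min V E (\<pi> h)"
    and "make_reduced_indset_zdd E q \<pi> \<delta> (sorted_list_of_set V) 1 (\<lambda>h. rc {} (\<pi> h)) [] = (r, T)"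
  shows "is_zdd T r \<and>
    zdd_family T r = {S \<in> maximal_stable_sets V E. \<forall>h\<in>{1..q}. rc S (\<pi> h) \<le> \<delta> h}"
proof -
  have fin: "finite V" using assms(1) by (simp add: simple_graph_def)
  have irrefl: "{x} \<notin> E" for x
    using assms(1) by (fastforce simp: simple_graph_def)
  have "0 \<le> \<pi> h v" if "h \<in> {1..q}" "v \<in> V" for h v
    using assms(2,3) that by blast
  then have "encodes [] V (bounded_completions E q \<pi> \<delta> (\<lambda>h. rc {} (\<pi> h)) V V) (r, T)"
    using encodes_make_reduced_indset_zdd[of "sorted_list_of_set V" 1 "[]" q \<pi> E \<delta>
        "\<lambda>h. rc {} (\<pi> h)"] fin assms(8)
    by (simp add: wf_table_def)
  then have "wf_table T" "labelled_in T V r"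
    and fam: "zdd_family T r = bounded_completions E q \<pi> \<delta> (\<lambda>h. rc {} (\<pi> h)) V V"
    by (auto simp: encodes_def)
  then show ?thesis
    using is_zdd_wf_table maximal_stable_sets_eq_completions[OF irrefl, of V]
    by (auto simp: fam bounded_completions_def rc_def)
qed

end
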